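(* Let $M\ge1$ be an integer, let $\delta t>0$, $E\in\mathbb R$, $\sigma\ge 1$, and let $L_0,U_0,L_1,U_1$ be real constants. If the uncertainty set $\hat{\boldsymbol\eta}_a\subset\mathbb R^{2M}$ (defined in the context) has nonempty interior, then the semi-infinite constraint $$\delta t\sum_{k=1}^M\left(a_1^kN^k+a_0^k\right)\le E\qquad\forall\,(a_0,a_1)\in\hat{\boldsymbol\eta}_a$$ on the vector $(N^k)_{1\le k\le M}$ of real numbers is equivalent to the following set of constraints: a vector $(N^k)_{1\le k\le M}$ satisfies the semi-infinite constraint if and only if there exist real numbers $\beta^k,\gamma^k$ ($1\le k\le M$) and $\theta$ such that $$\sum_{k=1}^M U_1\beta^k-\sum_{k=1}^M L_1\gamma^k+\frac{MU_1}{\sigma}\,\theta+MU_0\,\delta t\le E,$$ $$\beta^k-\gamma^k+\theta=\delta t\,N^k\qquad\forall\,1\le k\le M,$$ $$\beta^k\ge0,\quad\gamma^k\ge0,\quad\theta\ge0\qquad\forall\,1\le k\le M.$$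
   Context: $N^k$ is the (link) occupancy at the $k$-th of $M$ time steps of size $\delta t$, and $E$ is a prescribed bound. With $a_0=(a_0^k:1\le k\le M)$ and $a_1=(a_1^k:1\le k\le M)$, the uncertainty set is $$\hat{\boldsymbol\eta}_a=\Big\{(a_0,a_1):\ L_0\le a_0^k\le U_0,\ L_1\le a_1^k\le U_1\ \ \forall\,1\le k\le M;\ \ \sum_{k=1}^M a_1^k\le\frac{MU_1}{\sigma}\Big\}\subset\mathbb R^{2M}.$$ *)

theory Defs
  imports "HOL-Analysis.Analysis"
begin

text \<open>
  The type \<open>'m\<close> indexes the time steps, so \<open>M = CARD('m)\<close> (automatically at least 1),
  and \<open>(real^'m) \<times> (real^'m)\<close> with the product topology plays the role of \<open>\<real>\<close> to the
  power \<open>2M\<close>; a pair \<open>(a0, a1)\<close> is the stacked parameter vector.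
\<close>

definition uncertainty_set ::
  "real \<Rightarrow> real \<Rightarrow> real \<Rightarrow> real \<Rightarrow> real \<Rightarrow> ((real^'m) \<times> (real^'m)) set"
where
  "uncertainty_set L0 U0 L1 U1 \<sigma> =
     {(a0, a1). (\<forall>k. L0 \<le> a0 $ k \<and> a0 $ k \<le> U0 \<and> L1 \<le> a1 $ k \<and> a1 $ k \<le> U1) \<and>
                (\<Sum>k\<in>UNIV. a1 $ k) \<le> real CARD('m) * U1 / \<sigma>}"

end

theory Submission
  imports Defs
begin

text \<open>
  In the worst case each \<^term>\<open>a0 $ k\<close> sits at its upper bound, because it enters the constraint
  with the positive coefficient \<open>dt\<close>. What is left is to maximise the linear functional with
  coefficients \<open>c k = dt * N k\<close> over a box cut by one budget inequality, the continuous knapsack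
  problem. The system in \<open>\<beta>\<close>, \<open>\<gamma>\<close>, \<open>\<theta>\<close> is its linear programming dual: \<open>\<beta>\<close> prices
  the upper bounds, \<open>\<gamma>\<close> the lower bounds and \<open>\<theta>\<close> the budget. So the equivalence is weak
  duality (\<open>budgeted_box_weak_duality\<close>) in one direction and strong duality
  (\<open>budgeted_box_strong_duality\<close>) in the other.

  Once \<open>\<theta>\<close> is fixed, the best \<open>\<beta> k\<close> and \<open>\<gamma> k\<close> are the positive and negative parts of
  \<open>c k - \<theta>\<close>, so strong duality only asks for one good number. It is read off a maximiser \<open>a\<close>,
  which exists by compactness. Moving budget from one coordinate to another cannot help there,
  nor can lowering one coordinate alone; so every coordinate that could still be lowered has a
  nonnegative coefficient, at least as large as that of every coordinate that could still be
  raised. Hence some \<open>\<theta> \<ge> 0\<close> separates the two groups of coefficients, and \<open>\<theta> = 0\<close> will do if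
  budget is left over, since then raising alone cannot help either (\<open>maximiser_threshold\<close>).
  These are the complementary slackness conditions, and they make the two objective values agree.
\<close>

section \<open>Linear programming over a box with a budget\<close>

definition budgeted_box :: "real^'m \<Rightarrow> real^'m \<Rightarrow> real \<Rightarrow> (real^'m) set" where
  "budgeted_box L U C = {a. (\<forall>k. L $ k \<le> a $ k \<and> a $ k \<le> U $ k) \<and> (\<Sum>k\<in>UNIV. a $ k) \<le> C}"

lemma compact_budgeted_box: "compact (budgeted_box L U C :: (real^'m) set)"
proof -
  have "budgeted_box L U C = cbox L U \<inter> {a :: real^'m. (\<Sum>k\<in>UNIV. a $ k) \<le> C}"
    by (auto simp: budgeted_box_def mem_box_cart)
  moreover have "closed {a :: real^'m. (\<Sum>k\<in>UNIV. a $ k) \<le> C}"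
    by (intro closed_Collect_le continuous_intros)
  ultimately show ?thesis
    by (simp add: compact_Int_closed[OF compact_cbox])
qed

lemma budgeted_box_maximiser_exists:
  fixes c :: "real^'m"
  assumes "budgeted_box L U C \<noteq> {}"
  obtains a where "a \<in> budgeted_box L U C"
    and "\<And>b. b \<in> budgeted_box L U C \<Longrightarrow> (\<Sum>k\<in>UNIV. c $ k * b $ k) \<le> (\<Sum>k\<in>UNIV. c $ k * a $ k)"
proof -
  have "continuous_on (budgeted_box L U C) (\<lambda>a. \<Sum>k\<in>UNIV. c $ k * a $ k)"
    by (intro continuous_intros)
  from continuous_attains_sup[OF compact_budgeted_box assms this] show ?thesis
    using that by blast
qed

lemma budgeted_box_weak_duality:
  fixes c :: "real^'m"
  assumes a: "a \<in> budgeted_box L U C"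
    and dual: "\<And>k. \<beta> $ k - \<gamma> $ k + \<theta> = c $ k"
    and nonneg: "\<And>k. \<beta> $ k \<ge> 0" "\<And>k. \<gamma> $ k \<ge> 0" "\<theta> \<ge> 0"
  shows "(\<Sum>k\<in>UNIV. c $ k * a $ k)
           \<le> (\<Sum>k\<in>UNIV. U $ k * \<beta> $ k) - (\<Sum>k\<in>UNIV. L $ k * \<gamma> $ k) + C * \<theta>"
proof -
  have "c $ k * a $ k \<le> U $ k * \<beta> $ k - L $ k * \<gamma> $ k + \<theta> * a $ k" for k
  proof -
    have "a $ k * \<beta> $ k \<le> U $ k * \<beta> $ k" "L $ k * \<gamma> $ k \<le> a $ k * \<gamma> $ k"
      using a nonneg by (auto simp: budgeted_box_def intro!: mult_right_mono)
    then show ?thesis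
      by (simp add: dual[symmetric] algebra_simps)
  qed
  then have "(\<Sum>k\<in>UNIV. c $ k * a $ k) \<le> (\<Sum>k\<in>UNIV. U $ k * \<beta> $ k - L $ k * \<gamma> $ k + \<theta> * a $ k)"
    by (rule sum_mono)
  also have "\<dots> = (\<Sum>k\<in>UNIV. U $ k * \<beta> $ k) - (\<Sum>k\<in>UNIV. L $ k * \<gamma> $ k) + \<theta> * (\<Sum>k\<in>UNIV. a $ k)"
    by (simp add: sum.distrib sum_subtractf sum_distrib_left)
  also have "\<theta> * (\<Sum>k\<in>UNIV. a $ k) \<le> \<theta> * C"
    using a nonneg by (auto simp: budgeted_box_def intro!: mult_left_mono)
  finally show ?thesis
    by (simp add: mult.commute)
qed

text \<open>
  First-order optimality along the directions in which one coordinate is raised by \<open>p\<close> times,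
  and another lowered by \<open>q\<close> times, a small step. Taking \<open>p\<close> and \<open>q\<close> in \<open>{0, 1}\<close> covers
  raising alone, lowering alone, and exchange.
\<close>

lemma maximiser_no_improving_step:
  fixes a c :: "real^'m"
  assumes max: "\<And>b. b \<in> budgeted_box L U C
                  \<Longrightarrow> (\<Sum>k\<in>UNIV. c $ k * b $ k) \<le> (\<Sum>k\<in>UNIV. c $ k * a $ k)"
    and "e > 0"
    and step: "a + e *\<^sub>R (p *\<^sub>R axis i 1 - q *\<^sub>R axis j 1) \<in> budgeted_box L U C"
  shows "p * c $ i \<le> q * c $ j"
proof -
  let ?d = "p *\<^sub>R axis i 1 - q *\<^sub>R axis j 1 :: real^'m"
  have "c \<bullet> (a + e *\<^sub>R ?d) \<le> c \<bullet> a"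
    using max[OF step] by (simp add: inner_vec_def)
  then have "e * (p * c $ i - q * c $ j) \<le> 0"
    by (simp add: inner_right_distrib inner_diff_right inner_axis algebra_simps)
  then show ?thesis
    using \<open>e > 0\<close> by (simp add: mult_le_0_iff)
qed

lemma sum_axis: "(\<Sum>k\<in>UNIV. axis i (1::real) $ k) = 1"
  by (simp add: axis_def)

text \<open>
  The number \<open>\<theta>\<close> is the Lagrange multiplier of the budget: the largest coefficient among
  the coordinates that could still be raised, or zero if all of these are negative.
\<close>

lemma maximiser_threshold:
  fixes a c :: "real^'m"
  assumes a: "a \<in> budgeted_box L U C"
    and max: "\<And>b. b \<in> budgeted_box L U C
                \<Longrightarrow> (\<Sum>k\<in>UNIV. c $ k * b $ k) \<le> (\<Sum>k\<in>UNIV. c $ k * a $ k)"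
  obtains \<theta> where "\<theta> \<ge> 0"
    and "\<And>k. a $ k < U $ k \<Longrightarrow> c $ k \<le> \<theta>"
    and "\<And>k. L $ k < a $ k \<Longrightarrow> \<theta> \<le> c $ k"
    and "(\<Sum>k\<in>UNIV. a $ k) < C \<Longrightarrow> \<theta> = 0"
proof -
  have box: "L $ k \<le> a $ k" "a $ k \<le> U $ k" and budget: "(\<Sum>k\<in>UNIV. a $ k) \<le> C" for k
    using a by (auto simp: budgeted_box_def)
  have exchange: "c $ i \<le> c $ j" if "a $ i < U $ i" "L $ j < a $ j" for i j
  proof -
    define e where "e = min (U $ i - a $ i) (a $ j - L $ j)"
    have e: "e > 0" "e \<le> U $ i - a $ i" "e \<le> a $ j - L $ j"
      using that by (auto simp: e_def)
    let ?b = "a + e *\<^sub>R (1 *\<^sub>R axis i 1 - 1 *\<^sub>R axis j 1)"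
    have "(\<Sum>k\<in>UNIV. ?b $ k) = (\<Sum>k\<in>UNIV. a $ k)"
      by (simp add: sum.distrib sum_subtractf sum_axis flip: sum_distrib_left)
    moreover have "L $ k \<le> ?b $ k \<and> ?b $ k \<le> U $ k" for k
      using box[of k] e by (auto simp: axis_def)
    ultimately have "?b \<in> budgeted_box L U C"
      using budget unfolding budgeted_box_def by simp
    from maximiser_no_improving_step[OF max e(1) this] show ?thesis
      by simp
  qed
  have lower: "0 \<le> c $ j" if "L $ j < a $ j" for j
  proof -
    define e where "e = a $ j - L $ j"
    have e: "e > 0"
      using that by (simp add: e_def)
    let ?b = "a + e *\<^sub>R (0 *\<^sub>R axis j 1 - 1 *\<^sub>R axis j 1)"
    have "(\<Sum>k\<in>UNIV. ?b $ k) = (\<Sum>k\<in>UNIV. a $ k) - e"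
      by (simp add: sum.distrib sum_subtractf sum_negf sum_axis flip: sum_distrib_left)
    moreover have "L $ k \<le> ?b $ k \<and> ?b $ k \<le> U $ k" for k
      using box[of k] e by (auto simp: axis_def e_def)
    ultimately have "?b \<in> budgeted_box L U C"
      using budget e unfolding budgeted_box_def by simp
    from maximiser_no_improving_step[OF max e this] show ?thesis
      by simp
  qed
  have raise: "c $ i \<le> 0" if "a $ i < U $ i" "(\<Sum>k\<in>UNIV. a $ k) < C" for i
  proof -
    define e where "e = min (U $ i - a $ i) (C - (\<Sum>k\<in>UNIV. a $ k))"
    have e: "e > 0" "e \<le> U $ i - a $ i" "e \<le> C - (\<Sum>k\<in>UNIV. a $ k)"
      using that by (auto simp: e_def)
    let ?b = "a + e *\<^sub>R (1 *\<^sub>R axis i 1 - 0 *\<^sub>R axis i 1)"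
    have "(\<Sum>k\<in>UNIV. ?b $ k) = (\<Sum>k\<in>UNIV. a $ k) + e"
      by (simp add: sum.distrib sum_subtractf sum_axis flip: sum_distrib_left)
    moreover have "L $ k \<le> ?b $ k \<and> ?b $ k \<le> U $ k" for k
      using box[of k] e by (auto simp: axis_def)
    ultimately have "?b \<in> budgeted_box L U C"
      using e unfolding budgeted_box_def by simp
    from maximiser_no_improving_step[OF max e(1) this] show ?thesis
      by simp
  qed
  define T where "T = insert 0 {c $ i | i. a $ i < U $ i}"
  have "finite T"
    by (simp add: T_def)
  then have ge: "\<And>x. x \<in> T \<Longrightarrow> x \<le> Max T"
    by (rule Max_ge)
  have "Max T \<in> T"
    using \<open>finite T\<close> by (rule Max_in) (simp add: T_def)
  then have cases: "Max T = 0 \<or> (\<exists>i. a $ i < U $ i \<and> Max T = c $ i)"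
    unfolding T_def by blast
  show ?thesis
  proof
    show nonneg: "Max T \<ge> 0"
      by (rule ge) (simp add: T_def)
    show "Max T = 0" if "(\<Sum>k\<in>UNIV. a $ k) < C"
      using cases nonneg raise[OF _ that] by (metis order_antisym)
    show "c $ k \<le> Max T" if "a $ k < U $ k" for k
      using that by (intro ge) (auto simp: T_def)
    show "Max T \<le> c $ k" if "L $ k < a $ k" for k
      using cases exchange[OF _ that] lower[OF that] by metis
  qed
qed

theorem budgeted_box_strong_duality:
  fixes c :: "real^'m"
  assumes "budgeted_box L U C \<noteq> {}"
  obtains a \<beta> \<gamma> \<theta> where "a \<in> budgeted_box L U C"
    and "\<And>k. \<beta> $ k - \<gamma> $ k + \<theta> = c $ k"
    and "\<And>k. \<beta> $ k \<ge> 0" "\<And>k. \<gamma> $ k \<ge> 0" "\<theta> \<ge> 0"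
    and "(\<Sum>k\<in>UNIV. U $ k * \<beta> $ k) - (\<Sum>k\<in>UNIV. L $ k * \<gamma> $ k) + C * \<theta>
           = (\<Sum>k\<in>UNIV. c $ k * a $ k)"
proof -
  obtain a where a: "a \<in> budgeted_box L U C"
    and max: "\<And>b. b \<in> budgeted_box L U C
                \<Longrightarrow> (\<Sum>k\<in>UNIV. c $ k * b $ k) \<le> (\<Sum>k\<in>UNIV. c $ k * a $ k)"
    using budgeted_box_maximiser_exists[OF assms] by blast
  obtain \<theta> where \<theta>: "\<theta> \<ge> 0"
    and up: "\<And>k. a $ k < U $ k \<Longrightarrow> c $ k \<le> \<theta>"
    and low: "\<And>k. L $ k < a $ k \<Longrightarrow> \<theta> \<le> c $ k"
    and slack: "(\<Sum>k\<in>UNIV. a $ k) < C \<Longrightarrow> \<theta> = 0"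
    using maximiser_threshold[OF a max] by blast
  define \<beta> \<gamma> :: "real^'m" where "\<beta> = (\<chi> k. max (c $ k - \<theta>) 0)" and "\<gamma> = (\<chi> k. max (\<theta> - c $ k) 0)"
  have \<beta>\<gamma>: "\<beta> $ k - \<gamma> $ k + \<theta> = c $ k" "\<beta> $ k \<ge> 0" "\<gamma> $ k \<ge> 0" for k
    by (auto simp: \<beta>_def \<gamma>_def)
  have "U $ k * \<beta> $ k - L $ k * \<gamma> $ k = c $ k * a $ k - \<theta> * a $ k" for k
  proof -
    have "L $ k \<le> a $ k" "a $ k \<le> U $ k"
      using a by (auto simp: budgeted_box_def)
    then have "(U $ k - a $ k) * \<beta> $ k = 0" "(a $ k - L $ k) * \<gamma> $ k = 0"
      using up[of k] low[of k] by (force simp: \<beta>_def \<gamma>_def)+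
    then show ?thesis
      by (auto simp: \<beta>\<gamma>(1)[of k, symmetric] algebra_simps)
  qed
  then have "(\<Sum>k\<in>UNIV. U $ k * \<beta> $ k) - (\<Sum>k\<in>UNIV. L $ k * \<gamma> $ k)
               = (\<Sum>k\<in>UNIV. c $ k * a $ k) - \<theta> * (\<Sum>k\<in>UNIV. a $ k)"
    by (simp add: sum_distrib_left flip: sum_subtractf)
  moreover have "\<theta> * (\<Sum>k\<in>UNIV. a $ k) = C * \<theta>"
    using slack a by (cases "(\<Sum>k\<in>UNIV. a $ k) < C") (auto simp: budgeted_box_def)
  ultimately show ?thesis
    using that[OF a \<beta>\<gamma> \<theta>] by simp
qed

section \<open>The robust constraint\<close>

lemma uncertainty_set_iff:
  fixes a0 a1 :: "real^'m"
  shows "(a0, a1) \<in> uncertainty_set L0 U0 L1 U1 \<sigma> \<longleftrightarrow>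
     (\<forall>k. L0 \<le> a0 $ k \<and> a0 $ k \<le> U0) \<and>
     a1 \<in> budgeted_box (vec L1) (vec U1) (real CARD('m) * U1 / \<sigma>)"
  by (auto simp: uncertainty_set_def budgeted_box_def)

theorem corollary4p4:
  fixes dt E \<sigma> L0 U0 L1 U1 :: real
    and N :: "real^'m"
  assumes "dt > 0"
    and "\<sigma> \<ge> 1"
    and "interior (uncertainty_set L0 U0 L1 U1 \<sigma> :: ((real^'m) \<times> (real^'m)) set) \<noteq> {}"
  shows "(\<forall>(a0, a1) \<in> (uncertainty_set L0 U0 L1 U1 \<sigma> :: ((real^'m) \<times> (real^'m)) set).
            dt * (\<Sum>k\<in>UNIV. a1 $ k * N $ k + a0 $ k) \<le> E)
     \<longleftrightarrow>
     (\<exists>(\<beta> :: real^'m) (\<gamma> :: real^'m) (\<theta> :: real).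
        (\<Sum>k\<in>UNIV. U1 * \<beta> $ k) - (\<Sum>k\<in>UNIV. L1 * \<gamma> $ k)
            + real CARD('m) * U1 / \<sigma> * \<theta> + real CARD('m) * U0 * dt \<le> E \<and>
        (\<forall>k. \<beta> $ k - \<gamma> $ k + \<theta> = dt * N $ k) \<and>
        (\<forall>k. \<beta> $ k \<ge> 0 \<and> \<gamma> $ k \<ge> 0) \<and> \<theta> \<ge> 0)"
    (is "?robust \<longleftrightarrow> (\<exists>\<beta> \<gamma> \<theta>. ?dual \<beta> \<gamma> \<theta>)")
proof -
  let ?C = "real CARD('m) * U1 / \<sigma>"
  let ?A = "budgeted_box (vec L1) (vec U1) ?C :: (real^'m) set"
  let ?c = "dt *\<^sub>R N"
  have split: "dt * (\<Sum>k\<in>UNIV. a1 $ k * N $ k + a0 $ k)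
                 = (\<Sum>k\<in>UNIV. ?c $ k * a1 $ k) + dt * (\<Sum>k\<in>UNIV. a0 $ k)" for a0 a1 :: "real^'m"
    by (simp add: sum.distrib sum_distrib_left algebra_simps)
  show ?thesis
  proof
    assume robust: ?robust
    obtain x0 x1 where x: "(x0, x1) \<in> (uncertainty_set L0 U0 L1 U1 \<sigma> :: ((real^'m) \<times> (real^'m)) set)"
      using assms(3) interior_subset by fast
    then have "L0 \<le> U0" "?A \<noteq> {}"
      unfolding uncertainty_set_iff by (auto intro: order_trans)
    from this(2) obtain a \<beta> \<gamma> \<theta> where a: "a \<in> ?A"
      and dual: "\<And>k. \<beta> $ k - \<gamma> $ k + \<theta> = ?c $ k"
        "\<And>k. \<beta> $ k \<ge> 0" "\<And>k. \<gamma> $ k \<ge> 0" "\<theta> \<ge> 0"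
      and val: "(\<Sum>k\<in>UNIV. vec U1 $ k * \<beta> $ k) - (\<Sum>k\<in>UNIV. vec L1 $ k * \<gamma> $ k) + ?C * \<theta>
                  = (\<Sum>k\<in>UNIV. ?c $ k * a $ k)"
      using budgeted_box_strong_duality[where c = ?c] by blast
    have "(vec U0, a) \<in> uncertainty_set L0 U0 L1 U1 \<sigma>"
      using a \<open>L0 \<le> U0\<close> by (simp add: uncertainty_set_iff)
    with robust have "dt * (\<Sum>k\<in>UNIV. a $ k * N $ k + vec U0 $ k) \<le> E"
      by blast
    then have "(\<Sum>k\<in>UNIV. ?c $ k * a $ k) + real CARD('m) * U0 * dt \<le> E"
      unfolding split by (simp add: mult_ac)
    with val dual have "?dual \<beta> \<gamma> \<theta>"
      by simp
    then show "\<exists>\<beta> \<gamma> \<theta>. ?dual \<beta> \<gamma> \<theta>"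
      by blast
  next
    assume "\<exists>\<beta> \<gamma> \<theta>. ?dual \<beta> \<gamma> \<theta>"
    then obtain \<beta> \<gamma> \<theta> where dual: "?dual \<beta> \<gamma> \<theta>"
      by blast
    have "dt * (\<Sum>k\<in>UNIV. a1 $ k * N $ k + a0 $ k) \<le> E"
      if "(a0, a1) \<in> uncertainty_set L0 U0 L1 U1 \<sigma>" for a0 a1 :: "real^'m"
    proof -
      have a1: "a1 \<in> ?A" and a0: "\<And>k. a0 $ k \<le> U0"
        using that by (auto simp: uncertainty_set_iff)
      have "(\<Sum>k\<in>UNIV. ?c $ k * a1 $ k)
              \<le> (\<Sum>k\<in>UNIV. vec U1 $ k * \<beta> $ k) - (\<Sum>k\<in>UNIV. vec L1 $ k * \<gamma> $ k) + ?C * \<theta>"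
        using dual by (intro budgeted_box_weak_duality[OF a1]) auto
      moreover have "(\<Sum>k\<in>UNIV. a0 $ k) \<le> real CARD('m) * U0"
        using sum_bounded_above[of UNIV "($) a0" U0] a0 by simp
      then have "dt * (\<Sum>k\<in>UNIV. a0 $ k) \<le> real CARD('m) * U0 * dt"
        using \<open>dt > 0\<close> by (simp add: mult.commute)
      ultimately show ?thesis
        using dual unfolding split by simp
    qed
    then show ?robust
      by blast
  qed
qed

end
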